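(* Let $G = K_{m,2m}$ be the complete bipartite graph with parts of sizes $m$ and $2m$. Then $\alpha(G) = 2\kappa(G) = 2m$, but the vertices of $G$ cannot be covered by at most two vertex-disjoint paths $P$ and $Q$.
   Context: $\alpha(G)$ denotes the independence number of $G$ (maximum size of an independent set of vertices) and $\kappa(G)$ denotes its (vertex) connectivity number. A collection of vertex-disjoint paths of $G$ covers the vertices of $G$ if every vertex of $G$ lies on one of the paths. The example is offered against the assertion that the vertices of any graph $G$ can be covered by at most $\lceil \alpha(G)/\kappa(G) \rceil$ vertex-disjoint paths.
   Formalization: That the vertices cannot be covered by at most two vertex-disjoint paths is stated only for m ≥ 3, since K_{1,2} is itself a path and K_{2,4} is covered by two disjoint 3-vertex paths; α(G) = 2κ(G) = 2m is stated for all m ≥ 1. *)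

theory Defs
  imports "Graph_Theory.Graph_Theory"
begin

(* Undirected simple graphs are the finite symmetric loop-free digraphs without parallel arcs,
   i.e. the locale graph of Graph_Theory. *)

definition independent_vertices :: "('a, 'b) pre_digraph \<Rightarrow> 'a set \<Rightarrow> bool" where
  "independent_vertices G S \<longleftrightarrow>
     S \<subseteq> verts G \<and> (\<forall>u\<in>S. \<forall>v\<in>S. (u, v) \<notin> arcs_ends G)"

definition independence_number :: "('a, 'b) pre_digraph \<Rightarrow> nat" where
  "independence_number G = Max (card ` {S. independent_vertices G S})"

definition vertex_connected :: "nat \<Rightarrow> ('a, 'b) pre_digraph \<Rightarrow> bool" where
  "vertex_connected k G \<longleftrightarrow>
     k < card (verts G) \<and>
     (\<forall>X. X \<subseteq> verts G \<and> card X < k \<longrightarrow> connected (G \<restriction> (verts G - X)))"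

(* Every nonempty graph is 0-connected; for the graph without vertices the set is empty and the
   value is unspecified. For a complete graph on n vertices the value is n - 1. *)
definition connectivity_number :: "('a, 'b) pre_digraph \<Rightarrow> nat" where
  "connectivity_number G = Max {k. vertex_connected k G}"

(* A vpath is a nonempty list of distinct vertices, consecutive ones being adjacent;
   a single vertex is a path. *)
definition disjoint_path_cover :: "('a, 'b) pre_digraph \<Rightarrow> 'a list set \<Rightarrow> bool" where
  "disjoint_path_cover G \<P> \<longleftrightarrow>
     (\<forall>p\<in>\<P>. vpath p G) \<and>
     pairwise (\<lambda>p q. set p \<inter> set q = {}) \<P> \<and>
     (\<Union>p\<in>\<P>. set p) = verts G"

definition path_coverable :: "('a, 'b) pre_digraph \<Rightarrow> nat \<Rightarrow> bool" where
  "path_coverable G k \<longleftrightarrow> (\<exists>\<P>. finite \<P> \<and> card \<P> \<le> k \<and> disjoint_path_cover G \<P>)"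

end

(* Deleting the small part U of K_{m,n} leaves no arcs, whereas deleting fewer than m vertices
   leaves a vertex in each part. A path meets an independent set S in at most one vertex more than
   the complement of S, so k disjoint covering paths force card S to exceed the size of the
   complement by at most k; for K_{m,2m} with the large part as S this gives 2m <= m + 2. *)
theory Submission
  imports Defs
begin

lemma arcs_ends_induce_subgraph:
  "arcs_ends (G \<restriction> X) = arcs_ends G \<inter> X \<times> X"
  by (auto simp: arcs_ends_conv induce_subgraph_def)

text \<open>What survives a deletion hitting neither part completely is again complete bipartite
  with both sides nonempty; any two of its vertices are joined by at most two arcs.\<close>

lemma connected_induce_complete_bipartite:
  assumes E: "arcs_ends G = U \<times> V \<union> V \<times> U"
    and A: "A \<subseteq> U" "A \<noteq> {}" and B: "B \<subseteq> V" "B \<noteq> {}"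
  shows "connected (G \<restriction> (A \<union> B))"
proof -
  obtain a b where ab: "a \<in> A" "b \<in> B" using A(2) B(2) by auto
  let ?R = "rtrancl_on (A \<union> B) ((arcs_ends (G \<restriction> (A \<union> B)))\<^sup>s)"
  have arc: "(x, y) \<in> ?R" if "(x, y) \<in> A \<times> B \<union> B \<times> A" for x y
  proof -
    have "(x, y) \<in> (arcs_ends (G \<restriction> (A \<union> B)))\<^sup>s"
      using that A(1) B(1) by (auto simp: arcs_ends_induce_subgraph E symcl_def)
    with that show ?thesis
      by (intro rtrancl_on_into_rtrancl_on[OF rtrancl_on_refl]) auto
  qed
  have "(x, y) \<in> ?R" if xy: "x \<in> A \<union> B" "y \<in> A \<union> B" for x y
  proof -
    \<comment> \<open>For \<open>x\<close> and \<open>y\<close> on opposite sides take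
      \<open>z = y\<close>; on the same side, \<open>a\<close> or \<open>b\<close> from the other
      side is a common neighbour.\<close>
    obtain z where "(x, z) \<in> A \<times> B \<union> B \<times> A" "z = y \<or> (z, y) \<in> A \<times> B \<union> B \<times> A"
      using xy ab by blast
    then show ?thesis using arc by (metis rtrancl_on_trans)
  qed
  then show ?thesis using ab by (auto simp: connected_conv)
qed

text \<open>No arc runs inside \<open>S\<close>, so reachability there is mere equality.\<close>

lemma not_connected_induce_independent:
  assumes "independent_vertices G S" "x \<in> S" "y \<in> S" "x \<noteq> y"
  shows "\<not> connected (G \<restriction> S)"
proof
  assume "connected (G \<restriction> S)"
  then have "(x, y) \<in> rtrancl_on S ((arcs_ends (G \<restriction> S))\<^sup>s)"
    using assms by (auto simp: connected_conv)
  moreover have "(arcs_ends (G \<restriction> S))\<^sup>s = {}"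
    using assms(1) by (auto simp: arcs_ends_induce_subgraph independent_vertices_def symcl_def)
  ultimately show False using assms(4) by (auto elim: rtrancl_on.cases)
qed

lemma vpath_card_independent_le:
  assumes "vpath p G" "independent_vertices G S"
  shows "card (set p \<inter> S) \<le> card (set p - S) + 1"
proof -
  have "vwalk p G" using assms(1) by auto
  \<comment> \<open>Strengthened for the induction: when the head lies outside \<open>S\<close>, the
    excess of 1 is not allowed. Prepending a vertex of \<open>S\<close> is then safe, because its
    successor must lie outside \<open>S\<close>.\<close>
  then have "length (filter (\<lambda>x. x \<in> S) p) + (if hd p \<in> S then 0 else 1)
      \<le> length (filter (\<lambda>x. x \<notin> S) p) + 1"
    by induction (use assms(2) in \<open>auto simp: independent_vertices_def split: if_splits\<close>)
  moreover have "card (set p \<inter> S) = length (filter (\<lambda>x. x \<in> S) p)"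
    "card (set p - S) = length (filter (\<lambda>x. x \<notin> S) p)"
    using assms(1) by (auto simp flip: distinct_card intro!: arg_cong[where f = card])
  ultimately show ?thesis by linarith
qed

lemma path_coverable_card_independent_le:
  assumes "path_coverable G k" "independent_vertices G S"
  shows "card S \<le> card (verts G - S) + k"
proof -
  obtain P where P: "finite P" "card P \<le> k" "\<forall>p\<in>P. vpath p G"
      "pairwise (\<lambda>p q. set p \<inter> set q = {}) P" and cover: "(\<Union>p\<in>P. set p) = verts G"
    using assms(1) by (auto simp: path_coverable_def disjoint_path_cover_def)
  have "S = (\<Union>p\<in>P. set p \<inter> S)"
    using assms(2) cover by (auto simp: independent_vertices_def)
  then have "card S = card (\<Union>p\<in>P. set p \<inter> S)" by simp
  also have "\<dots> = (\<Sum>p\<in>P. card (set p \<inter> S))"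
    using P by (intro card_UN_disjoint) (auto simp: pairwise_def)
  also have "\<dots> \<le> (\<Sum>p\<in>P. card (set p - S) + 1)"
    using P assms(2) by (intro sum_mono vpath_card_independent_le) auto
  \<comment> \<open>Each path contributes an excess of at most one, in total the number of
    paths.\<close>
  also have "\<dots> = (\<Sum>p\<in>P. card (set p - S)) + card P" by (simp only: sum.distrib card_eq_sum)
  also have "(\<Sum>p\<in>P. card (set p - S)) = card (\<Union>p\<in>P. set p - S)"
    using P by (intro card_UN_disjoint[symmetric]) (auto simp: pairwise_def)
  also have "(\<Union>p\<in>P. set p - S) = verts G - S" using cover by auto
  finally show ?thesis using P(2) by linarith
qed

context
  fixes G :: "('a, 'b) pre_digraph" and U V :: "'a set"
  assumes fin: "finite (verts G)"
    and verts: "verts G = U \<union> V" "U \<inter> V = {}"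
    and ends: "arcs_ends G = U \<times> V \<union> V \<times> U"
    and card_le: "card U \<le> card V"
begin

lemma independent_part: "independent_vertices G V"
  using verts ends by (auto simp: independent_vertices_def)

lemma independence_number_complete_bipartite: "independence_number G = card V"
  unfolding independence_number_def
proof (rule Max_eqI)
  show "finite (card ` {S. independent_vertices G S})"
    by (rule finite_imageI, rule finite_subset[of _ "Pow (verts G)"])
      (auto simp: fin independent_vertices_def)
  show "card V \<in> card ` {S. independent_vertices G S}"
    using independent_part by blast
  fix n assume "n \<in> card ` {S. independent_vertices G S}"
  then obtain S where S: "independent_vertices G S" and n: "n = card S" by auto
  \<comment> \<open>A set meeting both parts would contain both ends of an arc.\<close>
  have "S \<subseteq> U \<or> S \<subseteq> V"
    using S unfolding independent_vertices_def verts ends by blast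
  then have "card S \<le> card U \<or> card S \<le> card V"
    using fin verts by (metis card_mono finite_Un)
  then show "n \<le> card V" using card_le n by auto
qed

text \<open>The smaller part is a minimum separator. Two vertices in \<open>V\<close> ensure that
  deleting \<open>U\<close> really disconnects the graph.\<close>

lemma connectivity_number_complete_bipartite:
  assumes "2 \<le> card V"
  shows "connectivity_number G = card U"
  unfolding connectivity_number_def
proof (rule Max_eqI)
  show "finite {k. vertex_connected k G}"
    by (rule finite_subset[of _ "{..card (verts G)}"]) (auto simp: vertex_connected_def)
  have finUV: "finite U" "finite V" using fin verts by auto
  show "card U \<in> {k. vertex_connected k G}"
    unfolding vertex_connected_def mem_Collect_eq
  proof (intro conjI allI impI)
    show "card U < card (verts G)"
      using finUV verts assms by (simp add: card_Un_disjoint)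
    fix X assume X: "X \<subseteq> verts G \<and> card X < card U"
    then have "finite X" using fin finite_subset by blast
    \<comment> \<open>\<open>X\<close> is smaller than either part, so it contains neither.\<close>
    then have "U - X \<noteq> {}" "V - X \<noteq> {}"
      using X card_le by (metis card_mono Diff_eq_empty_iff leD le_trans)+
    then have "connected (G \<restriction> ((U - X) \<union> (V - X)))"
      by (intro connected_induce_complete_bipartite[OF ends]) auto
    moreover have "verts G - X = (U - X) \<union> (V - X)" using verts by auto
    ultimately show "connected (G \<restriction> (verts G - X))" by simp
  qed
  fix k assume "k \<in> {k. vertex_connected k G}"
  \<comment> \<open>If \<open>k\<close> exceeded \<open>card U\<close>, then \<open>X = U\<close>
    would be an admissible deletion set.\<close>
  then have k: "connected (G \<restriction> (verts G - U))" if "card U < k"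
    using that verts by (auto simp: vertex_connected_def)
  obtain x y where "x \<in> V" "y \<in> V" "x \<noteq> y"
    using assms by (meson card_2_iff' obtain_subset_with_card_n subsetD)
  then have "\<not> connected (G \<restriction> V)"
    using not_connected_induce_independent[OF independent_part] by blast
  moreover have "verts G - U = V" using verts by auto
  ultimately show "k \<le> card U" using k by (metis not_le)
qed

end

text \<open>The quotient of independence number by connectivity is 2, so the refuted assertion would
  promise two paths. The restriction to m \<ge> 3 is genuine: K_{1,2} is itself a path, and K_{2,4}
  is covered by a path on five vertices and a single vertex.\<close>

theorem mainTheorem3:
  fixes G :: "('a, 'b) pre_digraph" and m :: nat
  assumes "m \<ge> 1"
    and "complete_bipartite_digraph m (2 * m) G"
  shows "independence_number G = 2 * connectivity_number G
       \<and> 2 * connectivity_number G = 2 * m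
       \<and> (m \<ge> 3 \<longrightarrow> \<not> path_coverable G 2)"
proof -
  obtain U V where UV: "verts G = U \<union> V" "U \<inter> V = {}"
    and card: "card U = m" "card V = 2 * m" and ends: "arcs_ends G = U \<times> V \<union> V \<times> U"
    and G: "graph G"
    using assms(2) unfolding complete_bipartite_digraph_def by blast
  interpret graph G by (rule G)
  have le: "card U \<le> card V" using card by simp
  note bip = finite_verts UV ends le
  have "m \<le> 2" if "path_coverable G 2"
  proof -
    have "verts G - V = U" using UV by auto
    then show ?thesis
      using path_coverable_card_independent_le[OF that independent_part[OF bip]] card by simp
  qed
  \<comment> \<open>Here \<open>m \<ge> 1\<close> supplies the condition
    \<open>2 \<le> card V\<close>.\<close>
  then show ?thesis
    using independence_number_complete_bipartite[OF bip]
      connectivity_number_complete_bipartite[OF bip] card assms(1) by auto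
qed

end
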